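(* Let $m,k\in\mathbb{N}$. If $m\in D(k)$, then there exist $a\in\mathbb{Z}$ and $a_i\in\{0,\dots,p_i-1\}$, $i=1,\dots,k$, such that $\{a_i \bmod p_i\}_{i=1}^k$ is a covering of $\langle a\rangle_{m-1}$.
   Context: $\mathbb{N}$ denotes the positive integers, $p_i$ the $i$-th prime ($p_1=2$), and $p_k\#=\prod_{i=1}^k p_i$. For $k\in\mathbb{N}$, let $c_{k,1}<c_{k,2}<\dots$ be the increasing enumeration of all $x\in\mathbb{N}$ with $\gcd(x,p_k\#)=1$, and let $D(k)=(c_{k,i+1}-c_{k,i})_{i\ge1}$; $m\in D(k)$ means that $m$ occurs as a term of this sequence. For $a\in\mathbb{Z}$ and $m\in\mathbb{N}$, $\langle a\rangle_m$ denotes the finite sequence of consecutive integers $a,a+1,\dots,a+m-1$. For primes $\pi_i$ and $a_i\in\{0,\dots,\pi_i-1\}$, $i=1,\dots,k$, the set of residue classes $\{a_i\bmod\pi_i\}_{i=1}^k$ is a covering of $\langle a\rangle_m$ if for every $j\in\{0,\dots,m-1\}$ there is $i\in\{1,\dots,k\}$ with $a+j\equiv a_i\pmod{\pi_i}$. *)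

theory Defs
  imports "HOL-Number_Theory.Number_Theory" "HOL-Library.Infinite_Set"
begin

text \<open>All sequences are indexed from 1, so that \<^term>\<open>i = (0::nat)\<close> is never meaningful below;
  \<^const>\<open>enumerate\<close> itself counts from 0.\<close>

definition nth_prime :: "nat \<Rightarrow> nat" where
  "nth_prime i = enumerate {p::nat. prime p} (i - 1)"

definition primorial :: "nat \<Rightarrow> nat" where
  "primorial k = (\<Prod>i=1..k. nth_prime i)"

definition coprimes :: "nat \<Rightarrow> nat set" where
  "coprimes k = {x. x > 0 \<and> gcd x (primorial k) = 1}"

definition coprime_seq :: "nat \<Rightarrow> nat \<Rightarrow> nat" where
  "coprime_seq k i = enumerate (coprimes k) (i - 1)"

text \<open>The subtraction on the naturals below does not truncate, because \<^term>\<open>coprime_seq k\<close> enumerates an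
  infinite set (lemma \<open>infinite_coprimes\<close>) in increasing order.\<close>

definition gap_seq :: "nat \<Rightarrow> nat \<Rightarrow> nat" where
  "gap_seq k i = coprime_seq k (i + 1) - coprime_seq k i"

definition occurs_in_gap_seq :: "nat \<Rightarrow> nat \<Rightarrow> bool" where
  "occurs_in_gap_seq m k \<longleftrightarrow> (\<exists>i\<ge>1. gap_seq k i = m)"

text \<open>The residue classes \<open>r i mod \<pi> i\<close>, \<open>1 \<le> i \<le> k\<close>, cover the \<open>m\<close> consecutive integers
  \<open>a, \<dots>, a + m - 1\<close>. That \<open>\<pi> i\<close> is prime and \<open>r i < \<pi> i\<close> are conditions on the data, to be
  stated where the notion is used.\<close>

definition is_covering :: "nat \<Rightarrow> (nat \<Rightarrow> nat) \<Rightarrow> (nat \<Rightarrow> nat) \<Rightarrow> int \<Rightarrow> nat \<Rightarrow> bool" where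
  "is_covering k \<pi> r a m \<longleftrightarrow>
     (\<forall>j<m. \<exists>i\<in>{1..k}. [a + int j = int (r i)] (mod int (\<pi> i)))"

lemma prime_nth_prime: "prime (nth_prime i)"
  using enumerate_in_set[OF primes_infinite, of "i - 1"] by (simp add: nth_prime_def)

lemma infinite_coprimes: "infinite (coprimes k)"
proof -
  have pos: "primorial k > 0"
    by (auto simp: primorial_def intro!: prod_pos prime_gt_0_nat prime_nth_prime)
  have "inj (\<lambda>n. n * primorial k + 1)"
    using pos by (auto simp: inj_on_def)
  then have "infinite (range (\<lambda>n. n * primorial k + 1))"
    by (rule range_inj_infinite)
  moreover have "gcd (n * primorial k + 1) (primorial k) = 1" for n
    by (metis add.commute gcd.commute gcd_1_nat gcd_add_mult)
  then have "range (\<lambda>n. n * primorial k + 1) \<subseteq> coprimes k"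
    by (auto simp: coprimes_def)
  ultimately show ?thesis
    using finite_subset by blast
qed

end

theory Submission
  imports Defs
begin

text \<open>
  The residue class \<open>0\<close> can be taken for every prime. If \<open>c < c'\<close> are consecutive integers
  coprime to the primorial and \<open>m = c' - c\<close>, then each of the \<open>m - 1\<close> integers
  \<open>c + 1, \<dots>, c' - 1\<close> shares a factor with the primorial, so it is divisible by one of the first
  \<open>k\<close> primes (\<open>not_coprime_primorial_imp_dvd\<close>). Hence the classes \<open>0 mod p\<^sub>i\<close> cover the block that
  starts at \<open>a = c + 1\<close>.
\<close>

lemma enumerate_gap:
  fixes S :: "nat set"
  assumes "infinite S" and "enumerate S n < x" and "x < enumerate S (Suc n)"
  shows "x \<notin> S"
proof
  assume "x \<in> S"
  with assms(2) have "(LEAST s. s \<in> S \<and> enumerate S n < s) \<le> x"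
    by (intro Least_le conjI)
  with assms(3) show False
    unfolding enumerate_Suc''[OF assms(1)] by linarith
qed

lemma not_coprime_primorial_imp_dvd:
  assumes "\<not> coprime x (primorial k)"
  shows "\<exists>i\<in>{1..k}. nth_prime i dvd x"
proof (rule ccontr)
  assume "\<not> ?thesis"
  then have "coprime x (nth_prime i)" if "i \<in> {1..k}" for i
    using that prime_imp_coprime[OF prime_nth_prime] by (metis coprime_commute)
  then have "coprime x (primorial k)"
    unfolding primorial_def by (intro prod_coprime_right) auto
  with assms show False by simp
qed

theorem proposition1p8:
  fixes m k :: nat
  assumes "m \<ge> 1" and "k \<ge> 1"
    and "occurs_in_gap_seq m k"
  shows "\<exists>(a::int) (r::nat \<Rightarrow> nat).
           (\<forall>i\<in>{1..k}. r i \<in> {0..nth_prime i - 1}) \<and>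
           is_covering k nth_prime r a (m - 1)"
proof -
  from assms(3) obtain n where "n \<ge> 1" and gap: "gap_seq k n = m"
    by (auto simp: occurs_in_gap_seq_def)
  define c where "c = coprime_seq k n"
  have covered: "\<exists>i\<in>{1..k}. nth_prime i dvd c + 1 + j" if "j < m - 1" for j
  proof -
    have "c < c + 1 + j" and "c + 1 + j < coprime_seq k (n + 1)"
      using that gap by (simp_all add: gap_seq_def c_def)
    then have "c + 1 + j \<notin> coprimes k"
      using enumerate_gap[OF infinite_coprimes[of k], of "n - 1"] \<open>n \<ge> 1\<close>
      by (simp add: c_def coprime_seq_def)
    then have "\<not> coprime (c + 1 + j) (primorial k)"
      unfolding coprimes_def coprime_iff_gcd_eq_1 by simp
    then show ?thesis
      by (rule not_coprime_primorial_imp_dvd)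
  qed
  have "is_covering k nth_prime (\<lambda>_. 0) (int (c + 1)) (m - 1)"
    unfolding is_covering_def
  proof (intro allI impI)
    fix j assume "j < m - 1"
    then obtain i where "i \<in> {1..k}" and "nth_prime i dvd c + 1 + j"
      using covered by blast
    then have "int (nth_prime i) dvd int (c + 1) + int j"
      by (metis of_nat_add of_nat_dvd_iff)
    then have "[int (c + 1) + int j = int 0] (mod int (nth_prime i))"
      by (simp add: cong_0_iff)
    with \<open>i \<in> {1..k}\<close>
    show "\<exists>i\<in>{1..k}. [int (c + 1) + int j = int 0] (mod int (nth_prime i))"
      by blast
  qed
  then show ?thesis
    by (intro exI[of _ "int (c + 1)"] exI[of _ "\<lambda>_. 0"]) simp
qed

end
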